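(* Let $s, r, k, n_1, \ldots, n_r$ be positive integers with $2\leq s\leq r$, $n_1\leq n_2\leq\cdots\leq n_r$ and $k\leq n_1$. Then $$ex_s\left(K_{n_1,\ldots,n_r}^{(s)},\, kK_r^{(s)}\right)=\left(\sum_{\substack{A\subset\{1,\ldots,r\}\\ |A|=s}}\ \prod_{i\in A}n_i\right)-\prod_{i=1}^{s}n_i+(k-1)\prod_{i=2}^{s}n_i.$$
   Context: An $s$-uniform hypergraph ($s$-graph) is a hypergraph all of whose edges have exactly $s$ vertices. For two $s$-graphs $H$ and $F$, $H$ is $F$-free if it contains no copy of $F$ as a (not necessarily induced) subgraph, and the Turán number $ex_s(H,F)$ is the maximum number of edges of an $F$-free subgraph of $H$. $K_t^{(s)}$ denotes the complete $s$-graph on $t$ vertices, and $kK_t^{(s)}$ denotes the $s$-graph consisting of $k$ vertex-disjoint copies of $K_t^{(s)}$. For disjoint vertex sets $V_1,\ldots,V_r$ with $|V_i|=n_i$, the complete $r$-partite $s$-graph $K_{n_1,\ldots,n_r}^{(s)}$ has vertex set $V_1\cup\cdots\cup V_r$ and its edges are all $s$-element subsets $S$ of $V_1\cup\cdots\cup V_r$ with $|S\cap V_i|\leq 1$ for all $i=1,\ldots,r$. *)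

theory Defs
  imports "HOL-Library.Ramsey" "HOL-Library.Disjoint_Sets"
begin

datatype 'a hypergraph = Hypergraph (verts: "'a set") (edges: "'a set set")

(* nsets A s, written [A]^s in HOL-Library.Ramsey, is the set of all s-element finite subsets of A. *)
definition s_graph :: "nat \<Rightarrow> 'a hypergraph \<Rightarrow> bool" where
  "s_graph s H \<longleftrightarrow> finite (verts H) \<and> edges H \<subseteq> nsets (verts H) s"

definition subgraph :: "'a hypergraph \<Rightarrow> 'a hypergraph \<Rightarrow> bool" where
  "subgraph G H \<longleftrightarrow> verts G \<subseteq> verts H \<and> edges G \<subseteq> edges H"

definition contains_copy :: "'a hypergraph \<Rightarrow> 'b hypergraph \<Rightarrow> bool" where
  "contains_copy H F \<longleftrightarrow>
     (\<exists>f. inj_on f (verts F) \<and> f ` verts F \<subseteq> verts H \<and> (\<forall>e\<in>edges F. f ` e \<in> edges H))"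

definition is_free :: "'a hypergraph \<Rightarrow> 'b hypergraph \<Rightarrow> bool" where
  "is_free H F \<longleftrightarrow> \<not> contains_copy H F"

(* The maximum is over a finite set for every s-graph H, and that set is nonempty as soon as
   F has an edge; see turan_number_attained and turan_number_upper below. *)
definition turan_number :: "nat \<Rightarrow> 'a hypergraph \<Rightarrow> 'b hypergraph \<Rightarrow> nat" where
  "turan_number s H F = Max {card (edges G) |G. s_graph s G \<and> subgraph G H \<and> is_free G F}"

definition complete_hypergraph :: "nat \<Rightarrow> nat \<Rightarrow> nat hypergraph" where
  "complete_hypergraph s t = Hypergraph {1..t} (nsets {1..t} s)"

definition disjoint_copies :: "nat \<Rightarrow> 'a hypergraph \<Rightarrow> (nat \<times> 'a) hypergraph" where
  "disjoint_copies k F =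
     Hypergraph ({1..k} \<times> verts F) {Pair j ` e |j e. j \<in> {1..k} \<and> e \<in> edges F}"

definition complete_multipartite :: "nat \<Rightarrow> nat \<Rightarrow> (nat \<Rightarrow> 'a set) \<Rightarrow> 'a hypergraph" where
  "complete_multipartite s r V =
     Hypergraph (\<Union>i\<in>{1..r}. V i)
       {S \<in> nsets (\<Union>i\<in>{1..r}. V i) s. \<forall>i\<in>{1..r}. card (S \<inter> V i) \<le> 1}"

lemma s_graph_complete_hypergraph: "s_graph s (complete_hypergraph s t)"
  by (simp add: s_graph_def complete_hypergraph_def)

lemma s_graph_disjoint_copies:
  assumes "s_graph s F"
  shows "s_graph s (disjoint_copies k F)"
  using assms unfolding s_graph_def disjoint_copies_def nsets_def
  by (auto simp: card_image inj_on_def)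

lemma s_graph_complete_multipartite:
  assumes "\<And>i. i \<in> {1..r} \<Longrightarrow> finite (V i)"
  shows "s_graph s (complete_multipartite s r V)"
  using assms by (auto simp: s_graph_def complete_multipartite_def)

lemma finite_turan_candidates:
  assumes "s_graph s H"
  shows "finite {card (edges G) |G. s_graph s G \<and> subgraph G H \<and> is_free G F}"
proof -
  have fin: "finite (edges H)"
    using assms by (meson finite_imp_finite_nsets finite_subset s_graph_def)
  have "card (edges G) \<le> card (edges H)" if "subgraph G H" for G
    using that fin by (simp add: card_mono subgraph_def)
  then have "{card (edges G) |G. s_graph s G \<and> subgraph G H \<and> is_free G F} \<subseteq> {..card (edges H)}"
    by auto
  then show ?thesis
    by (rule finite_subset) simp
qed

lemma turan_number_upper:
  assumes "s_graph s H" "s_graph s G" "subgraph G H" "is_free G F"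
  shows "card (edges G) \<le> turan_number s H F"
  unfolding turan_number_def
  by (rule Max_ge[OF finite_turan_candidates[OF assms(1)]]) (use assms in blast)

lemma turan_number_attained:
  assumes "s_graph s H" "edges F \<noteq> {}"
  shows "\<exists>G. s_graph s G \<and> subgraph G H \<and> is_free G F \<and> card (edges G) = turan_number s H F"
proof -
  let ?G = "Hypergraph {} {} :: 'a hypergraph"
  have "s_graph s ?G \<and> subgraph ?G H \<and> is_free ?G F"
    using assms(2) by (auto simp: s_graph_def subgraph_def is_free_def contains_copy_def)
  then have "{card (edges G) |G. s_graph s G \<and> subgraph G H \<and> is_free G F} \<noteq> {}"
    by blast
  from Max_in[OF finite_turan_candidates[OF assms(1)] this] show ?thesis
    unfolding turan_number_def by force
qed

end

theory Submission
  imports Defs "HOL-Number_Theory.Cong"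
begin

text \<open>
  Write \<open>N(A)\<close> for the product of the part sizes over an index set \<open>A\<close>. An edge of the complete
  multipartite hypergraph is the image of a choice function \<open>u \<in> Pi\<^sub>E A V\<close> with \<open>card A = s\<close>, and a copy
  of the complete \<open>s\<close>-graph on \<open>r\<close> vertices is the image of a full transversal \<open>t \<in> Pi\<^sub>E {1..r} V\<close>: any two
  of its vertices share an edge because \<open>2 \<le> s \<le> r\<close>, so they lie in different parts.

  Lower bound (\<open>multipartite_lower\<close>). Fix \<open>k - 1\<close> vertices \<open>X\<close> of the smallest part, and delete the edges
  across the \<open>s\<close> smallest parts that avoid \<open>X\<close>. Each surviving copy meets those \<open>s\<close> parts in an edge, hence
  meets \<open>X\<close>, and \<open>k\<close> disjoint copies would need \<open>k\<close> vertices of \<open>X\<close>.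

  Upper bound (\<open>multipartite_upper\<close>). Let \<open>M\<close> be the set of missing edges, and call a transversal bad if it
  contains one of them. A missing edge with index set \<open>A\<close> lies in a fraction \<open>1 / N(A)\<close> of all transversals.
  This is at most \<open>1 / N({1..s})\<close>, since the first parts are the smallest, so at most a fraction
  \<open>card M / N({1..s})\<close> of the transversals is bad. Cyclic shifts inside the parts turn each transversal into
  \<open>n 1\<close> pairwise disjoint ones, and averaging over the starting transversal gives \<open>n 1\<close> disjoint
  transversals among which the fraction of bad ones is no larger than it is among all transversals
  (\<open>disjoint_transversals_few_bad\<close>). If no \<open>k\<close> of them are good, then at least \<open>n 1 - k + 1\<close> are bad, and
  \<open>card M \<ge> (n 1 - k + 1) * N({2..s})\<close> follows.
\<close>

section \<open>Crossing sets as images of choice functions\<close>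

lemma choice_image_subset:
  assumes disj: "disjoint_family_on V I" and "A \<subseteq> I" "B \<subseteq> I"
    and u: "u \<in> Pi\<^sub>E A V" and t: "t \<in> Pi\<^sub>E B V" and sub: "u ` A \<subseteq> t ` B" and "i \<in> A"
  shows "i \<in> B \<and> t i = u i"
proof -
  obtain j where j: "j \<in> B" "u i = t j" using sub \<open>i \<in> A\<close> by blast
  have "u i \<in> V i" "t j \<in> V j" using PiE_mem[OF u \<open>i \<in> A\<close>] PiE_mem[OF t j(1)] by auto
  then have "i = j"
    using disj j \<open>i \<in> A\<close> assms(2,3) unfolding disjoint_family_on_def by (metis IntI empty_iff subsetD)
  with j show ?thesis by simp
qed

lemma choice_image_inj:
  assumes disj: "disjoint_family_on V I" and "A \<subseteq> I" "B \<subseteq> I"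
    and u: "u \<in> Pi\<^sub>E A V" and t: "t \<in> Pi\<^sub>E B V" and eq: "u ` A = t ` B"
  shows "A = B \<and> u = t"
proof -
  have 1: "i \<in> B \<and> t i = u i" if "i \<in> A" for i
    using choice_image_subset[OF assms(1-5)] eq that by simp
  have 2: "i \<in> A \<and> u i = t i" if "i \<in> B" for i
    using choice_image_subset[OF disj \<open>B \<subseteq> I\<close> \<open>A \<subseteq> I\<close> t u] eq that by simp
  have "A = B" using 1 2 by blast
  moreover have "u = t"
    by (rule PiE_ext[OF u]) (use t 1 \<open>A = B\<close> in auto)
  ultimately show ?thesis ..
qed

lemma card_choice_image:
  assumes "disjoint_family_on V I" "A \<subseteq> I" "u \<in> Pi\<^sub>E A V"
  shows "card (u ` A) = card A"
proof (rule card_image, rule inj_onI)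
  fix i j assume "i \<in> A" "j \<in> A" "u i = u j"
  then have "u i \<in> V i \<inter> V j" using assms(3) by (metis IntI PiE_mem)
  then show "i = j"
    using assms \<open>i \<in> A\<close> \<open>j \<in> A\<close> unfolding disjoint_family_on_def by blast
qed

text \<open>
  For a crossing set \<open>S\<close>, the index set is \<open>{i. S \<inter> V i \<noteq> {}}\<close> and \<open>u i\<close> is the only vertex of \<open>S\<close> in
  \<open>V i\<close>. By \<open>choice_image_inj\<close> this description of an edge is unique, so edges are counted by
  counting choice functions.
\<close>
lemma edges_complete_multipartite:
  assumes disj: "disjoint_family_on V {1..r}"
  shows "edges (complete_multipartite s r V) = (\<Union>A\<in>nsets {1..r} s. (\<lambda>u. u ` A) ` Pi\<^sub>E A V)"
proof (intro equalityI subsetI)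
  fix S assume "S \<in> edges (complete_multipartite s r V)"
  then have S: "finite S" "card S = s" "S \<subseteq> (\<Union>i\<in>{1..r}. V i)"
    and cross: "\<And>i. i \<in> {1..r} \<Longrightarrow> card (S \<inter> V i) \<le> 1"
    by (auto simp: complete_multipartite_def nsets_def)
  define A where "A = {i\<in>{1..r}. S \<inter> V i \<noteq> {}}"
  have "\<exists>x. x \<in> S \<inter> V i" if "i \<in> A" for i using that by (auto simp: A_def)
  then obtain w where w: "\<And>i. i \<in> A \<Longrightarrow> w i \<in> S \<inter> V i" by metis
  define u where "u = restrict w A"
  have u: "u \<in> Pi\<^sub>E A V" using w by (auto simp: u_def)
  have "S \<subseteq> u ` A"
  proof
    fix x assume "x \<in> S"
    then obtain i where i: "i \<in> {1..r}" "x \<in> V i" using S by blast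
    then have "i \<in> A" using \<open>x \<in> S\<close> by (auto simp: A_def)
    have "w i \<in> S \<inter> V i" "x \<in> S \<inter> V i" using w \<open>i \<in> A\<close> \<open>x \<in> S\<close> i by auto
    with cross[OF i(1)] S(1) have "x = w i"
      by (metis One_nat_def card_le_Suc0_iff_eq finite_Int)
    then show "x \<in> u ` A" using \<open>i \<in> A\<close> by (auto simp: u_def)
  qed
  then have eq: "S = u ` A" using w by (auto simp: u_def)
  have "A \<subseteq> {1..r}" by (auto simp: A_def)
  with card_choice_image[OF disj this u] eq S
  have "A \<in> nsets {1..r} s" by (auto simp: nsets_def finite_subset)
  then show "S \<in> (\<Union>A\<in>nsets {1..r} s. (\<lambda>u. u ` A) ` Pi\<^sub>E A V)" using eq u by blast
next
  fix S assume "S \<in> (\<Union>A\<in>nsets {1..r} s. (\<lambda>u. u ` A) ` Pi\<^sub>E A V)"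
  then obtain A u where A: "A \<subseteq> {1..r}" "finite A" "card A = s"
    and u: "u \<in> Pi\<^sub>E A V" and S: "S = u ` A" by (auto simp: nsets_def)
  have "card (S \<inter> V i) \<le> 1" if i: "i \<in> {1..r}" for i
  proof -
    have "S \<inter> V i \<subseteq> {u i}"
    proof
      fix x assume "x \<in> S \<inter> V i"
      then obtain j where "j \<in> A" "x = u j" "x \<in> V i" using S by auto
      moreover have "u j \<in> V j" using u \<open>j \<in> A\<close> by auto
      ultimately have "i = j"
        using disj A(1) i unfolding disjoint_family_on_def by blast
      then show "x \<in> {u i}" using \<open>x = u j\<close> by simp
    qed
    then show ?thesis by (metis card.empty card_insert_disjoint card_mono empty_iff finite.intros One_nat_def)
  qed
  moreover have "S \<subseteq> (\<Union>i\<in>{1..r}. V i)"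
  proof
    fix x assume "x \<in> S"
    then obtain j where "j \<in> A" "x = u j" using S by auto
    then show "x \<in> (\<Union>i\<in>{1..r}. V i)" using A(1) u by blast
  qed
  ultimately show "S \<in> edges (complete_multipartite s r V)"
    using card_choice_image[OF disj A(1) u] A S by (auto simp: complete_multipartite_def nsets_def)
qed

lemma card_edges_complete_multipartite:
  assumes disj: "disjoint_family_on V {1..r}" and fin: "\<And>i. i \<in> {1..r} \<Longrightarrow> finite (V i)"
  shows "card (edges (complete_multipartite s r V)) = (\<Sum>A\<in>nsets {1..r} s. \<Prod>i\<in>A. card (V i))"
proof -
  have "card (\<Union>A\<in>nsets {1..r} s. (\<lambda>u. u ` A) ` Pi\<^sub>E A V)
      = (\<Sum>A\<in>nsets {1..r} s. card ((\<lambda>u. u ` A) ` Pi\<^sub>E A V))"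
  proof (rule card_UN_disjoint)
    show "finite (nsets {1..r} s)" by (simp add: finite_imp_finite_nsets)
    show "\<forall>A\<in>nsets {1..r} s. finite ((\<lambda>u. u ` A) ` Pi\<^sub>E A V)"
      using fin by (auto simp: nsets_def subset_iff intro!: finite_imageI finite_PiE)
    show "\<forall>A\<in>nsets {1..r} s. \<forall>B\<in>nsets {1..r} s. A \<noteq> B \<longrightarrow>
        (\<lambda>u. u ` A) ` Pi\<^sub>E A V \<inter> (\<lambda>u. u ` B) ` Pi\<^sub>E B V = {}"
    proof (intro ballI impI equals0I)
      fix A B S assume AB: "A \<in> nsets {1..r} s" "B \<in> nsets {1..r} s" "A \<noteq> B"
        and "S \<in> (\<lambda>u. u ` A) ` Pi\<^sub>E A V \<inter> (\<lambda>u. u ` B) ` Pi\<^sub>E B V"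
      then obtain u t where "u \<in> Pi\<^sub>E A V" "t \<in> Pi\<^sub>E B V" "u ` A = t ` B" by auto
      then show False using choice_image_inj[OF disj, of A B u t] AB by (simp add: nsets_def)
    qed
  qed
  also have "\<dots> = (\<Sum>A\<in>nsets {1..r} s. \<Prod>i\<in>A. card (V i))"
  proof (rule sum.cong[OF refl])
    fix A assume A: "A \<in> nsets {1..r} s"
    then have "inj_on (\<lambda>u. u ` A) (Pi\<^sub>E A V)"
      using choice_image_inj[OF disj] by (intro inj_onI) (auto simp: nsets_def)
    then show "card ((\<lambda>u. u ` A) ` Pi\<^sub>E A V) = (\<Prod>i\<in>A. card (V i))"
      using A by (simp add: card_image card_PiE nsets_def)
  qed
  finally show ?thesis by (simp add: edges_complete_multipartite[OF disj])
qed

section \<open>Disjoint transversals by averaging over cyclic shifts\<close>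

text \<open>Number the elements of \<open>S\<close> by residues modulo \<open>card S\<close>; then \<open>\<rho> j\<close> is addition of \<open>j\<close>.\<close>
lemma cyclic_shifts:
  assumes "finite S"
  shows "\<exists>\<rho> :: nat \<Rightarrow> 'a \<Rightarrow> 'a. (\<forall>j. \<forall>x\<in>S. \<rho> j x \<in> S) \<and> (\<forall>j. inj_on (\<rho> j) S) \<and>
    (\<forall>x\<in>S. inj_on (\<lambda>j. \<rho> j x) {..<card S})"
proof -
  obtain h where h: "bij_betw h {0..<card S} S" using ex_bij_betw_nat_finite[OF assms] by blast
  define g where "g = inv_into {0..<card S} h"
  define \<rho> where "\<rho> j x = h ((j + g x) mod card S)" for j x
  have g: "g x < card S" if "x \<in> S" for x
    using bij_betw_inv_into[OF h] that by (fastforce simp: g_def bij_betw_def)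
  have ginj: "inj_on g S" using bij_betw_inv_into[OF h] by (simp add: g_def bij_betw_def)
  have heq: "[a = b] (mod card S)" if "h (a mod card S) = h (b mod card S)" "0 < card S" for a b
    using that h unfolding cong_def bij_betw_def inj_on_def by simp
  show ?thesis
  proof (intro exI[of _ \<rho>] conjI allI ballI)
    fix j x assume "x \<in> S"
    then have "0 < card S" using g by fastforce
    then show "\<rho> j x \<in> S" using h by (auto simp: \<rho>_def bij_betw_def)
  next
    fix j show "inj_on (\<rho> j) S"
    proof (rule inj_onI)
      fix x y assume xy: "x \<in> S" "y \<in> S" "\<rho> j x = \<rho> j y"
      then have "[j + g x = j + g y] (mod card S)" using heq g by (fastforce simp: \<rho>_def)
      then have "g x = g y" using g xy by (simp add: cong_add_lcancel_nat cong_less_modulus_unique_nat)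
      then show "x = y" using ginj xy by (simp add: inj_on_eq_iff)
    qed
  next
    fix x assume x: "x \<in> S"
    show "inj_on (\<lambda>j. \<rho> j x) {..<card S}"
    proof (rule inj_onI)
      fix i j assume ij: "i \<in> {..<card S}" "j \<in> {..<card S}" "\<rho> i x = \<rho> j x"
      then have "[i + g x = j + g x] (mod card S)" using heq g[OF x] by (fastforce simp: \<rho>_def)
      then show "i = j" using ij by (simp add: cong_add_rcancel_nat cong_less_modulus_unique_nat)
    qed
  qed
qed

text \<open>
  For each \<open>j\<close>, shifting every coordinate by \<open>j\<close> is injective on transversals, so at most \<open>card Bad\<close>
  starting transversals become bad after \<open>j\<close> shifts. Summing over \<open>j < m\<close> shows that some starting transversal
  has no more than the average number \<open>m * card Bad / card (Pi\<^sub>E I V)\<close> of bad shifts. The bound is stated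
  without division.
\<close>
lemma disjoint_transversals_few_bad:
  assumes "finite I" and V: "\<And>i. i \<in> I \<Longrightarrow> finite (V i) \<and> V i \<noteq> {} \<and> m \<le> card (V i)"
    and Bad: "Bad \<subseteq> Pi\<^sub>E I V"
  obtains \<tau> :: "nat \<Rightarrow> 'i \<Rightarrow> 'a" where
    "\<And>j. \<tau> j \<in> Pi\<^sub>E I V" "\<And>i. i \<in> I \<Longrightarrow> inj_on (\<lambda>j. \<tau> j i) {..<m}"
    "card {j\<in>{..<m}. \<tau> j \<in> Bad} * card (Pi\<^sub>E I V) \<le> m * card Bad"
proof -
  let ?P = "Pi\<^sub>E I V"
  have finP: "finite ?P" using assms by (auto intro: finite_PiE)
  have neP: "?P \<noteq> {}" using V by (simp add: PiE_eq_empty_iff)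
  have finB: "finite Bad" using Bad finP by (rule finite_subset)
  have "\<exists>\<rho>. (\<forall>j. \<forall>x\<in>V i. \<rho> j x \<in> V i) \<and> (\<forall>j. inj_on (\<rho> j) (V i)) \<and>
      (\<forall>x\<in>V i. inj_on (\<lambda>j. \<rho> j x) {..<card (V i)})" if "i \<in> I" for i
    using cyclic_shifts V[OF that] by blast
  then obtain \<rho> where \<rho>: "\<And>i j x. i \<in> I \<Longrightarrow> x \<in> V i \<Longrightarrow> \<rho> i j x \<in> V i"
    "\<And>i j. i \<in> I \<Longrightarrow> inj_on (\<rho> i j) (V i)"
    "\<And>i x. i \<in> I \<Longrightarrow> x \<in> V i \<Longrightarrow> inj_on (\<lambda>j. \<rho> i j x) {..<card (V i)}"
    by metis
  define \<sigma> where "\<sigma> t j = (\<lambda>i\<in>I. \<rho> i j (t i))" for t and j :: nat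
  have \<sigma>: "\<sigma> t j \<in> ?P" if "t \<in> ?P" for t j
    using that \<rho>(1) by (auto simp: \<sigma>_def)
  have \<sigma>_inj: "inj_on (\<lambda>t. \<sigma> t j) ?P" for j
  proof (rule inj_onI)
    fix t t' assume t: "t \<in> ?P" "t' \<in> ?P" "\<sigma> t j = \<sigma> t' j"
    show "t = t'"
    proof (rule PiE_ext[OF t(1,2)])
      fix i assume i: "i \<in> I"
      then have "\<rho> i j (t i) = \<rho> i j (t' i)" using fun_cong[OF t(3), of i] by (simp add: \<sigma>_def)
      then show "t i = t' i" using \<rho>(2)[OF i] t i by (meson PiE_mem inj_onD)
    qed
  qed
  define c where "c t = card {j\<in>{..<m}. \<sigma> t j \<in> Bad}" for t
  have "(\<Sum>t\<in>?P. c t) = (\<Sum>t\<in>?P. \<Sum>j<m. of_bool (\<sigma> t j \<in> Bad))"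
    by (simp add: c_def sum.If_cases of_bool_def Int_def)
  also have "\<dots> = (\<Sum>j<m. \<Sum>t\<in>?P. of_bool (\<sigma> t j \<in> Bad))" by (rule sum.swap)
  also have "\<dots> = (\<Sum>j<m. card {t\<in>?P. \<sigma> t j \<in> Bad})"
    using finP by (simp add: sum.If_cases of_bool_def Int_def)
  also have "\<dots> \<le> (\<Sum>j<m. card Bad)"
  proof (rule sum_mono)
    fix j
    have "inj_on (\<lambda>t. \<sigma> t j) {t\<in>?P. \<sigma> t j \<in> Bad}" by (rule inj_on_subset[OF \<sigma>_inj]) auto
    then show "card {t\<in>?P. \<sigma> t j \<in> Bad} \<le> card Bad"
      by (rule card_inj_on_le[OF _ _ finB]) auto
  qed
  finally have total: "(\<Sum>t\<in>?P. c t) \<le> m * card Bad" by simp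
  obtain t where t: "t \<in> ?P" "\<And>t'. t' \<in> ?P \<Longrightarrow> c t \<le> c t'"
    using arg_min_if_finite[OF finP neP, of c] by (metis linorder_le_less_linear)
  have "card ?P * c t \<le> (\<Sum>t\<in>?P. c t)" using sum_bounded_below[of ?P "c t" c] t by simp
  with total have "c t * card ?P \<le> m * card Bad" by (simp add: mult.commute)
  then show ?thesis
  proof (rule that[of "\<sigma> t", rotated 2, unfolded c_def[symmetric]])
    show "\<sigma> t j \<in> ?P" for j using \<sigma> t by blast
    show "inj_on (\<lambda>j. \<sigma> t j i) {..<m}" if i: "i \<in> I" for i
    proof -
      have "inj_on (\<lambda>j. \<rho> i j (t i)) {..<card (V i)}" using \<rho>(3)[OF i] t i by auto
      then show ?thesis using i V[OF i] by (auto simp: \<sigma>_def inj_on_def)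
    qed
  qed
qed

text \<open>
  The transversals through \<open>u ` A\<close> are the extensions of \<open>u\<close>, so there is one for each choice of the
  coordinates outside \<open>A\<close>.
\<close>
lemma card_transversals_through:
  assumes disj: "disjoint_family_on V I" and "finite I" and "A \<subseteq> I" and u: "u \<in> Pi\<^sub>E A V"
  shows "card {t \<in> Pi\<^sub>E I V. u ` A \<subseteq> t ` I} * (\<Prod>i\<in>A. card (V i)) = (\<Prod>i\<in>I. card (V i))"
proof -
  have "{t \<in> Pi\<^sub>E I V. u ` A \<subseteq> t ` I} = Pi\<^sub>E I (\<lambda>i. if i \<in> A then {u i} else V i)" (is "?L = ?R")
  proof (intro equalityI subsetI)
    fix t assume t: "t \<in> ?L"
    have "t i = u i" if "i \<in> A" for i
      using choice_image_subset[OF disj \<open>A \<subseteq> I\<close> subset_refl u _ _ that] t by blast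
    then show "t \<in> ?R" using t by auto
  next
    fix t assume t: "t \<in> ?R"
    have eq: "t i = u i" if "i \<in> A" for i
      using PiE_mem[OF t, of i] that \<open>A \<subseteq> I\<close> by auto
    have "t i \<in> V i" if "i \<in> I" for i
      using PiE_mem[OF t that] u by (cases "i \<in> A") auto
    then have "t \<in> Pi\<^sub>E I V" using t by (auto simp: PiE_iff)
    then show "t \<in> ?L" using eq \<open>A \<subseteq> I\<close> by auto (metis image_eqI subsetD)
  qed
  then have "card ?L = (\<Prod>i\<in>I. if i \<in> A then 1 else card (V i))"
    using \<open>finite I\<close> by (auto simp: card_PiE intro!: prod.cong)
  also have "\<dots> = (\<Prod>i\<in>I - A. card (V i))"
    using \<open>finite I\<close> by (auto simp: prod.If_cases Diff_eq)
  finally show ?thesis using prod.subset_diff[OF \<open>A \<subseteq> I\<close> \<open>finite I\<close>, of "\<lambda>i. card (V i)"] by simp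
qed

text \<open>Replacing the largest index of \<open>A\<close>, which is at least \<open>card A\<close>, by \<open>card A\<close> only decreases the product.\<close>
lemma prod_initial_segment_le:
  fixes n :: "nat \<Rightarrow> nat"
  assumes "mono_on {1..r} n" "A \<subseteq> {1..r}" "card A = s"
  shows "(\<Prod>i=1..s. n i) \<le> (\<Prod>i\<in>A. n i)"
  using assms(2,3)
proof (induction s arbitrary: A)
  case (Suc s)
  have fin: "finite A" using Suc.prems by (auto intro: finite_subset)
  define M where "M = Max A"
  have "A \<noteq> {}" using Suc.prems by auto
  then have M: "M \<in> A" using fin by (simp add: M_def)
  have "A \<subseteq> {1..M}" using Suc.prems fin by (auto simp: M_def)
  then have "Suc s \<le> M" using card_mono[of "{1..M}" A] Suc.prems by simp
  then have le: "n (Suc s) \<le> n M"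
    using assms(1) M Suc.prems by (intro mono_onD[OF assms(1)]) auto
  have "(\<Prod>i=1..s. n i) \<le> (\<Prod>i\<in>A - {M}. n i)"
    using Suc M fin by (intro Suc.IH) auto
  with le show ?case using prod.remove[OF fin M, of n] by (simp add: mult.commute mult_le_mono)
next
  case 0
  then have "A = {}" by (auto dest: finite_subset)
  then show ?case by simp
qed

section \<open>The two bounds\<close>

lemma contains_copyI_disjoint_transversals:
  assumes G: "s_graph s G" and "0 < s" "s \<le> r" and disj: "disjoint_family_on V {1..r}"
    and t: "\<And>j. j \<in> {1..k} \<Longrightarrow> t j \<in> Pi\<^sub>E {1..r} V"
    and inj: "\<And>i. i \<in> {1..r} \<Longrightarrow> inj_on (\<lambda>j. t j i) {1..k}"
    and good: "\<And>j A. j \<in> {1..k} \<Longrightarrow> A \<in> nsets {1..r} s \<Longrightarrow> t j ` A \<in> edges G"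
  shows "contains_copy G (disjoint_copies k (complete_hypergraph s r))"
  unfolding contains_copy_def
proof (intro exI[of _ "\<lambda>(j, i). t j i"] conjI ballI)
  show "inj_on (\<lambda>(j, i). t j i) (verts (disjoint_copies k (complete_hypergraph s r)))"
  proof (rule inj_onI, clarsimp simp: disjoint_copies_def complete_hypergraph_def)
    fix j i j' i' assume ji: "Suc 0 \<le> j" "j \<le> k" "Suc 0 \<le> j'" "j' \<le> k" "Suc 0 \<le> i" "i \<le> r" "Suc 0 \<le> i'" "i' \<le> r"
      and eq: "t j i = t j' i'"
    have "t j i \<in> V i" "t j' i' \<in> V i'" using t[of j] t[of j'] ji by auto
    then have "i = i'" using disj eq ji unfolding disjoint_family_on_def
      by (metis IntI One_nat_def atLeastAtMost_iff empty_iff)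
    then show "j = j' \<and> i = i'" using inj_onD[OF inj[of i], of j j'] ji eq by simp
  qed
  show "(\<lambda>(j, i). t j i) ` verts (disjoint_copies k (complete_hypergraph s r)) \<subseteq> verts G"
  proof (clarsimp simp: disjoint_copies_def complete_hypergraph_def)
    fix j i assume ji: "Suc 0 \<le> j" "j \<le> k" "Suc 0 \<le> i" "i \<le> r"
    \<comment> \<open>The vertex lies in \<open>verts G\<close> because some \<open>s\<close> of the \<open>r\<close> indices include \<open>i\<close>.\<close>
    obtain B where B: "{i} \<subseteq> B" "B \<subseteq> {1..r}" "card B = s"
      using exists_subset_between[of "{i}" s "{1..r}"] ji assms(2,3) by auto
    then have "B \<in> nsets {1..r} s" by (auto simp: nsets_def finite_subset)
    then have "t j ` B \<in> edges G" using good[of j] ji by auto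
    then have "t j ` B \<subseteq> verts G" using G by (auto simp: s_graph_def nsets_def)
    then show "t j i \<in> verts G" using B by auto
  qed
  fix e assume "e \<in> edges (disjoint_copies k (complete_hypergraph s r))"
  then obtain j A where "j \<in> {1..k}" "A \<in> nsets {1..r} s" "e = Pair j ` A"
    by (auto simp: disjoint_copies_def complete_hypergraph_def)
  then show "(\<lambda>(j, i). t j i) ` e \<in> edges G" using good by (simp add: image_image)
qed

text \<open>
  Double counting pairs of a missing edge and a transversal through it bounds the bad transversals
  (\<open>Bad_few\<close>). This is compared with the number of bad members in a disjoint family of size \<open>n 1\<close> that is
  no worse than average.
\<close>
lemma multipartite_upper:
  fixes n :: "nat \<Rightarrow> nat"
  assumes "0 < s" "s \<le> r" and pos: "\<And>i. i \<in> {1..r} \<Longrightarrow> 0 < n i"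
    and mono: "mono_on {1..r} n" and "k \<le> n 1"
    and disj: "disjoint_family_on V {1..r}"
    and V: "\<And>i. i \<in> {1..r} \<Longrightarrow> finite (V i) \<and> card (V i) = n i"
    and G: "s_graph s G"
    and free: "is_free G (disjoint_copies k (complete_hypergraph s r))"
  shows "(n 1 + 1 - k) * (\<Prod>i=2..s. n i) \<le> card (edges (complete_multipartite s r V) - edges G)"
proof -
  let ?I = "{1..r}" and ?K = "complete_multipartite s r V"
  let ?P = "Pi\<^sub>E ?I V"
  define M where "M = edges ?K - edges G"
  define Bad where "Bad = {t \<in> ?P. \<exists>e\<in>M. e \<subseteq> t ` ?I}"
  have finM: "finite M"
    using s_graph_complete_multipartite[of r V s] V unfolding M_def s_graph_def
    by (meson finite_Diff finite_imp_finite_nsets finite_subset)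
  have cardP: "card ?P = (\<Prod>i\<in>?I. n i)" using V by (simp add: card_PiE)
  then have "0 < card ?P" using pos by (simp add: prod_pos)

  have through: "card {t \<in> ?P. e \<subseteq> t ` ?I} * (\<Prod>i=1..s. n i) \<le> card ?P" if "e \<in> M" for e
  proof -
    have "e \<in> edges ?K" using that by (simp add: M_def)
    then obtain A u where A: "A \<subseteq> ?I" "card A = s" "u \<in> Pi\<^sub>E A V" "e = u ` A"
      unfolding edges_complete_multipartite[OF disj] by (auto simp: nsets_def)
    have "(\<Prod>i\<in>A. card (V i)) = (\<Prod>i\<in>A. n i)" "(\<Prod>i\<in>?I. card (V i)) = card ?P"
      using A V unfolding cardP by (auto intro!: prod.cong)
    then have "card {t \<in> ?P. e \<subseteq> t ` ?I} * (\<Prod>i\<in>A. n i) = card ?P"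
      using card_transversals_through[OF disj _ A(1,3)] A(4) by simp
    then show ?thesis
      using mult_le_mono2[OF prod_initial_segment_le[OF mono A(1,2)]] by metis
  qed
  have Bad_few: "card Bad * (\<Prod>i=1..s. n i) \<le> card M * card ?P"
  proof -
    have "Bad = (\<Union>e\<in>M. {t \<in> ?P. e \<subseteq> t ` ?I})" by (auto simp: Bad_def)
    then have "card Bad \<le> (\<Sum>e\<in>M. card {t \<in> ?P. e \<subseteq> t ` ?I})" by (simp add: card_UN_le[OF finM])
    then have "card Bad * (\<Prod>i=1..s. n i) \<le> (\<Sum>e\<in>M. card {t \<in> ?P. e \<subseteq> t ` ?I} * (\<Prod>i=1..s. n i))"
      using mult_le_mono1 unfolding sum_distrib_right[symmetric] by blast
    also have "\<dots> \<le> (\<Sum>e\<in>M. card ?P)" using through by (rule sum_mono)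
    finally show ?thesis by simp
  qed

  have parts: "finite (V i) \<and> V i \<noteq> {} \<and> n 1 \<le> card (V i)" if i: "i \<in> ?I" for i
    using V[OF i] pos[OF i] mono_onD[OF mono, of 1 i] i by auto
  have "Bad \<subseteq> ?P" by (auto simp: Bad_def)
  obtain \<tau> :: "nat \<Rightarrow> nat \<Rightarrow> 'a" where \<tau>: "\<And>j. \<tau> j \<in> ?P"
    "\<And>i. i \<in> ?I \<Longrightarrow> inj_on (\<lambda>j. \<tau> j i) {..<n 1}"
    "card {j\<in>{..<n 1}. \<tau> j \<in> Bad} * card ?P \<le> n 1 * card Bad"
    using disjoint_transversals_few_bad[OF finite_atLeastAtMost parts \<open>Bad \<subseteq> ?P\<close>] by blast
  define b where "b = card {j\<in>{..<n 1}. \<tau> j \<in> Bad}"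

  \<comment> \<open>Any \<open>k\<close> good transversals in the disjoint family would be a forbidden copy in \<open>G\<close>.\<close>
  have many_bad: "n 1 + 1 - k \<le> b"
  proof (rule ccontr)
    assume "\<not> n 1 + 1 - k \<le> b"
    then have "k + b \<le> n 1" using \<open>k \<le> n 1\<close> by simp
    define Good where "Good = {j\<in>{..<n 1}. \<tau> j \<notin> Bad}"
    have "Good \<union> {j\<in>{..<n 1}. \<tau> j \<in> Bad} = {..<n 1}" by (auto simp: Good_def)
    moreover have "card (Good \<union> {j\<in>{..<n 1}. \<tau> j \<in> Bad}) = card Good + b"
      unfolding b_def by (rule card_Un_disjoint) (auto simp: Good_def)
    ultimately have "card Good + b = card {..<n 1}" by simp
    with \<open>k + b \<le> n 1\<close> have "card {1..k} \<le> card Good" by simp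
    then obtain g where g: "inj_on g {1..k}" "g ` {1..k} \<subseteq> Good"
      using card_le_inj[of "{1..k}" Good] by (auto simp: Good_def)
    have "contains_copy G (disjoint_copies k (complete_hypergraph s r))"
    proof (rule contains_copyI_disjoint_transversals[OF G \<open>0 < s\<close> \<open>s \<le> r\<close> disj, where t = "\<lambda>j. \<tau> (g j)"])
      show "\<tau> (g j) \<in> ?P" for j by (rule \<tau>)
      show "inj_on (\<lambda>j. \<tau> (g j) i) {1..k}" if i: "i \<in> ?I" for i
        using comp_inj_on[OF g(1), of "\<lambda>j. \<tau> j i"] inj_on_subset[OF \<tau>(2)[OF i], of "g ` {1..k}"] g(2)
        by (auto simp: Good_def o_def)
      fix j A assume j: "j \<in> {1..k}" and A: "A \<in> nsets ?I s"
      then have "A \<subseteq> ?I" by (auto simp: nsets_def)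
      have "restrict (\<tau> (g j)) A \<in> Pi\<^sub>E A V"
        using \<tau>(1)[of "g j"] \<open>A \<subseteq> ?I\<close> by (auto simp: PiE_iff)
      then have "restrict (\<tau> (g j)) A ` A \<in> edges ?K"
        unfolding edges_complete_multipartite[OF disj] using A by blast
      then have "\<tau> (g j) ` A \<in> edges ?K" by simp
      moreover have "\<tau> (g j) \<notin> Bad" using g(2) j by (auto simp: Good_def image_subset_iff)
      then have "\<tau> (g j) ` A \<notin> M"
        using \<tau>(1)[of "g j"] image_mono[OF \<open>A \<subseteq> ?I\<close>, of "\<tau> (g j)"] unfolding Bad_def by simp blast
      ultimately show "\<tau> (g j) ` A \<in> edges G" by (simp add: M_def)
    qed
    with free show False by (simp add: is_free_def)
  qed

  define Q where "Q = (\<Prod>i=2..s. n i)"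
  have split: "(\<Prod>i=1..s. n i) = n 1 * Q"
    using \<open>0 < s\<close> by (simp add: Q_def prod.atLeast_Suc_atMost numeral_2_eq_2)
  have "(b * card ?P) * (n 1 * Q) \<le> (n 1 * card Bad) * (n 1 * Q)"
    using \<tau>(3) by (simp add: b_def)
  also have "\<dots> \<le> n 1 * (card M * card ?P)"
    using mult_le_mono2[OF Bad_few, of "n 1"] unfolding split by (simp add: mult.assoc)
  finally have "(n 1 * card ?P) * (b * Q) \<le> (n 1 * card ?P) * card M" by (simp add: algebra_simps)
  moreover have "0 < n 1 * card ?P" using pos[of 1] \<open>0 < card ?P\<close> assms(1,2) by simp
  ultimately have "b * Q \<le> card M" by simp
  then show ?thesis using mult_le_mono1[OF many_bad, of Q] unfolding M_def Q_def by linarith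
qed

text \<open>
  The removed family \<open>R\<close> consists of the edges across the first \<open>s\<close> parts that avoid \<open>X\<close>. A copy of the
  complete \<open>s\<close>-graph assigns its \<open>r\<close> vertices to distinct parts, so the assignment is onto, and the vertices
  assigned to the first \<open>s\<close> parts form an edge outside \<open>R\<close>, whose vertex in the first part must be in \<open>X\<close>.
\<close>
lemma multipartite_removal_free:
  fixes V :: "nat \<Rightarrow> 'a set"
  assumes "2 \<le> s" "s \<le> r" and disj: "disjoint_family_on V {1..r}"
    and X: "finite X" "card X < k"
  defines "R \<equiv> (\<lambda>u. u ` {1..s}) ` Pi\<^sub>E {1..s} (V(1 := V 1 - X))"
  shows "is_free (Hypergraph (\<Union>i\<in>{1..r}. V i) (edges (complete_multipartite s r V) - R))
           (disjoint_copies k (complete_hypergraph s r))"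
  unfolding is_free_def
proof
  let ?K = "complete_multipartite s r V"
  assume "contains_copy (Hypergraph (\<Union>i\<in>{1..r}. V i) (edges ?K - R))
           (disjoint_copies k (complete_hypergraph s r))"
  then obtain f where inj: "inj_on f ({1..k} \<times> {1..r})"
    and vert: "\<And>j i. j \<in> {1..k} \<Longrightarrow> i \<in> {1..r} \<Longrightarrow> f (j, i) \<in> (\<Union>i\<in>{1..r}. V i)"
    and edge0: "\<forall>e\<in>edges (disjoint_copies k (complete_hypergraph s r)). f ` e \<in> edges ?K - R"
    unfolding contains_copy_def by (auto simp: disjoint_copies_def complete_hypergraph_def image_subset_iff)
  have edge: "(\<lambda>i. f (j, i)) ` A \<in> edges ?K - R" if "j \<in> {1..k}" "A \<in> nsets {1..r} s" for j A
  proof -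
    have "Pair j ` A \<in> edges (disjoint_copies k (complete_hypergraph s r))"
      using that by (auto simp: disjoint_copies_def complete_hypergraph_def)
    with edge0 have "f ` Pair j ` A \<in> edges ?K - R" by blast
    then show ?thesis by (simp add: image_image)
  qed
  have "\<exists>i\<in>{1..r}. f (j, i) \<in> X" if j: "j \<in> {1..k}" for j
  proof -
    define F where "F i = f (j, i)" for i
    have F_inj: "inj_on F {1..r}"
      by (rule inj_onI) (use inj_onD[OF inj] j in \<open>force simp: F_def\<close>)
    have "\<exists>q. q \<in> {1..r} \<and> F i \<in> V q" if "i \<in> {1..r}" for i
      using vert[OF j that] by (auto simp: F_def)
    then obtain p where p: "\<And>i. i \<in> {1..r} \<Longrightarrow> p i \<in> {1..r} \<and> F i \<in> V (p i)" by metis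
    have p_inj: "inj_on p {1..r}"
    proof (rule inj_onI, rule ccontr)
      fix a b assume ab: "a \<in> {1..r}" "b \<in> {1..r}" "p a = p b" "a \<noteq> b"
      obtain B where B: "{a, b} \<subseteq> B" "B \<subseteq> {1..r}" "card B = s"
        using exists_subset_between[of "{a, b}" s "{1..r}"] ab assms(1,2) by auto
      then have "B \<in> nsets {1..r} s" by (auto simp: nsets_def finite_subset)
      then have FB: "F ` B \<in> edges ?K" using edge[OF j, of B] by (simp add: F_def)
      then have "card (F ` B \<inter> V (p a)) \<le> 1" "finite (F ` B)"
        using p ab by (auto simp: complete_multipartite_def nsets_def)
      moreover have "F a \<in> F ` B \<inter> V (p a)" "F b \<in> F ` B \<inter> V (p a)"
        using B(1) p[OF ab(1)] p[OF ab(2)] ab(3) by auto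
      ultimately have "F a = F b" by (metis One_nat_def card_le_Suc0_iff_eq finite_Int)
      then show False using inj_onD[OF F_inj] ab by blast
    qed
    then have p_surj: "p ` {1..r} = {1..r}"
      using p by (intro card_subset_eq) (auto simp: card_image)
    define q where "q = inv_into {1..r} p"
    have q: "q i \<in> {1..r} \<and> p (q i) = i" if "i \<in> {1..r}" for i
      using that p_surj unfolding q_def by (metis f_inv_into_f inv_into_into)
    define u where "u = (\<lambda>i\<in>{1..s}. F (q i))"
    have u_mem: "u i \<in> V i" if "i \<in> {1..s}" for i
      using that p[of "q i"] q[of i] \<open>s \<le> r\<close> by (auto simp: u_def)
    have "inj_on q {1..s}"
      using q \<open>s \<le> r\<close> by (intro inj_on_inverseI[of _ p]) auto
    then have "q ` {1..s} \<in> nsets {1..r} s"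
      using q \<open>s \<le> r\<close> by (auto simp: nsets_def card_image)
    then have "F ` q ` {1..s} \<notin> R" using edge[OF j] by (simp add: F_def)
    then have "u ` {1..s} \<notin> R" by (simp add: u_def image_image)
    then have "u \<notin> Pi\<^sub>E {1..s} (V(1 := V 1 - X))" unfolding R_def by blast
    then have "u 1 \<in> X"
      using u_mem unfolding u_def PiE_iff by (auto split: if_splits)
    then show ?thesis using q[of 1] assms(1,2) by (auto simp: u_def F_def)
  qed
  then obtain i where i: "\<And>j. j \<in> {1..k} \<Longrightarrow> i j \<in> {1..r} \<and> f (j, i j) \<in> X" by metis
  have "inj_on (\<lambda>j. f (j, i j)) {1..k}"
    by (rule inj_onI) (use inj_onD[OF inj] i in force)
  then have "card {1..k} \<le> card X" using i X(1) by (intro card_inj_on_le) auto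
  with X(2) show False by simp
qed

lemma multipartite_lower:
  fixes n :: "nat \<Rightarrow> nat" and V :: "nat \<Rightarrow> 'a set"
  assumes "2 \<le> s" "s \<le> r" "0 < k" "k \<le> n 1"
    and disj: "disjoint_family_on V {1..r}"
    and V: "\<And>i. i \<in> {1..r} \<Longrightarrow> finite (V i) \<and> card (V i) = n i"
  obtains G where "s_graph s G" "subgraph G (complete_multipartite s r V)"
    "is_free G (disjoint_copies k (complete_hypergraph s r))"
    "card (edges (complete_multipartite s r V)) = card (edges G) + (n 1 + 1 - k) * (\<Prod>i=2..s. n i)"
proof -
  let ?K = "complete_multipartite s r V"
  have V1: "finite (V 1)" "card (V 1) = n 1" using V[of 1] assms(1,2) by auto
  obtain X where X: "X \<subseteq> V 1" "card X = k - 1"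
    using obtain_subset_with_card_n[of "k - 1" "V 1"] V1 \<open>k \<le> n 1\<close> by (metis diff_le_self le_trans)
  have finX: "finite X" using X V1 finite_subset by blast
  define W where "W = V(1 := V 1 - X)"
  define R where "R = (\<lambda>u. u ` {1..s}) ` Pi\<^sub>E {1..s} W"
  define G where "G = Hypergraph (\<Union>i\<in>{1..r}. V i) (edges ?K - R)"
  have K: "s_graph s ?K" using V by (intro s_graph_complete_multipartite) blast
  have WV: "Pi\<^sub>E {1..s} W \<subseteq> Pi\<^sub>E {1..s} V" by (rule PiE_mono) (auto simp: W_def)
  have "{1..s} \<in> nsets {1..r} s" using \<open>s \<le> r\<close> by (auto simp: nsets_def)
  then have R_edges: "R \<subseteq> edges ?K"
    unfolding edges_complete_multipartite[OF disj] R_def using WV by blast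
  have "inj_on (\<lambda>u. u ` {1..s}) (Pi\<^sub>E {1..s} W)"
  proof (rule inj_onI)
    fix u t assume "u \<in> Pi\<^sub>E {1..s} W" "t \<in> Pi\<^sub>E {1..s} W" "u ` {1..s} = t ` {1..s}"
    then show "u = t" using choice_image_inj[OF disj, of "{1..s}" "{1..s}" u t] subsetD[OF WV] \<open>s \<le> r\<close> by auto
  qed
  then have "card R = (\<Prod>i=1..s. card (W i))" by (simp add: R_def card_image card_PiE)
  also have "\<dots> = card (W 1) * (\<Prod>i=2..s. card (W i))"
    using \<open>2 \<le> s\<close> by (simp add: prod.atLeast_Suc_atMost numeral_2_eq_2)
  also have "(\<Prod>i=2..s. card (W i)) = (\<Prod>i=2..s. n i)"
    using V \<open>s \<le> r\<close> by (intro prod.cong) (auto simp: W_def)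
  also have "card (W 1) = n 1 + 1 - k"
    using X V1 finX \<open>0 < k\<close> \<open>k \<le> n 1\<close> by (simp add: W_def card_Diff_subset)
  finally have cardR: "card R = (n 1 + 1 - k) * (\<Prod>i=2..s. n i)" .
  have finK: "finite (edges ?K)"
    using K unfolding s_graph_def by (meson finite_imp_finite_nsets finite_subset)
  show ?thesis
  proof
    show "s_graph s G" "subgraph G ?K"
      using K by (auto simp: s_graph_def subgraph_def G_def complete_multipartite_def)
    show "is_free G (disjoint_copies k (complete_hypergraph s r))"
      unfolding G_def R_def W_def
      by (rule multipartite_removal_free) (use assms X finX in auto)
    show "card (edges ?K) = card (edges G) + (n 1 + 1 - k) * (\<Prod>i=2..s. n i)"
      using cardR R_edges finK card_mono[OF finK R_edges]
      by (simp add: G_def card_Diff_subset finite_subset)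
  qed
qed

theorem theorem1p4:
  fixes s r k :: nat and n :: "nat \<Rightarrow> nat" and V :: "nat \<Rightarrow> 'a set"
  assumes "2 \<le> s" and "s \<le> r" and "0 < k"
    and "\<And>i. i \<in> {1..r} \<Longrightarrow> 0 < n i"
    and "mono_on {1..r} n"
    and "k \<le> n 1"
    and "disjoint_family_on V {1..r}"
    and "\<And>i. i \<in> {1..r} \<Longrightarrow> finite (V i) \<and> card (V i) = n i"
  shows "int (turan_number s (complete_multipartite s r V)
               (disjoint_copies k (complete_hypergraph s r))) =
         (\<Sum>A\<in>{A. A \<subseteq> {1..r} \<and> card A = s}. \<Prod>i\<in>A. int (n i))
           - (\<Prod>i=1..s. int (n i)) + (int k - 1) * (\<Prod>i=2..s. int (n i))"
proof -
  let ?K = "complete_multipartite s r V" and ?F = "disjoint_copies k (complete_hypergraph s r)"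
  let ?D = "(n 1 + 1 - k) * (\<Prod>i=2..s. n i)"
  have K: "s_graph s ?K" using assms(8) by (intro s_graph_complete_multipartite) blast
  then have finK: "finite (edges ?K)"
    unfolding s_graph_def by (meson finite_imp_finite_nsets finite_subset)
  have "{1..s} \<in> nsets {1..r} s" using assms(2) by (auto simp: nsets_def)
  moreover have "1 \<in> {1..k}" using assms(3) by simp
  ultimately have "Pair 1 ` {1..s} \<in> edges ?F"
    unfolding disjoint_copies_def complete_hypergraph_def by auto
  then have "edges ?F \<noteq> {}" by blast
  then obtain G where G: "s_graph s G" "subgraph G ?K" "is_free G ?F" "card (edges G) = turan_number s ?K ?F"
    using turan_number_attained[OF K] by blast
  have "?D \<le> card (edges ?K - edges G)"
    using multipartite_upper[OF _ assms(2,4,5,6,7,8) G(1,3)] assms(1) by simp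
  moreover have "edges G \<subseteq> edges ?K" using G(2) by (simp add: subgraph_def)
  ultimately have upper: "turan_number s ?K ?F + ?D \<le> card (edges ?K)"
    using G(4) finK card_mono[OF finK \<open>edges G \<subseteq> edges ?K\<close>]
    by (simp add: card_Diff_subset finite_subset)
  obtain G' where G': "s_graph s G'" "subgraph G' ?K" "is_free G' ?F"
    "card (edges ?K) = card (edges G') + ?D"
    using multipartite_lower[OF assms(1,2,3,6,7,8)] by blast
  have "card (edges G') \<le> turan_number s ?K ?F" using turan_number_upper[OF K G'(1,2,3)] .
  with upper G'(4) have eq: "card (edges ?K) = turan_number s ?K ?F + ?D" by linarith
  have nsets: "nsets {1..r} s = {A. A \<subseteq> {1..r} \<and> card A = s}"
    by (auto simp: nsets_def finite_subset)
  have "card (edges ?K) = (\<Sum>A\<in>nsets {1..r} s. \<Prod>i\<in>A. card (V i))"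
    using assms(8) by (intro card_edges_complete_multipartite[OF assms(7)]) blast
  also have "\<dots> = (\<Sum>A\<in>nsets {1..r} s. \<Prod>i\<in>A. n i)"
    using assms(8) by (intro sum.cong prod.cong) (auto simp: nsets_def)
  finally have "int (card (edges ?K)) = (\<Sum>A\<in>{A. A \<subseteq> {1..r} \<and> card A = s}. \<Prod>i\<in>A. int (n i))"
    unfolding nsets[symmetric] by simp
  moreover have "int ?D = (int (n 1) + 1 - int k) * (\<Prod>i=2..s. int (n i))"
    using assms(6) by (simp add: of_nat_diff)
  moreover have "(\<Prod>i=1..s. int (n i)) = int (n 1) * (\<Prod>i=2..s. int (n i))"
    using assms(1) by (simp add: prod.atLeast_Suc_atMost numeral_2_eq_2)
  ultimately show ?thesis using arg_cong[OF eq, of int] by (simp add: algebra_simps)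
qed

end
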